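(* Let $\rho:\mathrm{SL}_2(\mathbf{Z})\to\mathrm{GL}(V)$ be a finite-dimensional representation with roots $a_1\ge\cdots\ge a_d$. For $s=0,\dots,3$ let $\alpha_s$ be the multiplicity of the eigenvalue $i^s$ of $\rho(S)$, and for $r=0,\dots,5$ let $\beta_r$ be the multiplicity of the eigenvalue $\xi^r$ of $\rho(R)$, where $\xi=e^{2\pi i/6}$. Then precisely $\alpha_s$ roots of $\rho$ are congruent to $s$ modulo $4$, and precisely $\beta_r$ roots of $\rho$ are congruent to $r$ modulo $6$.
   Context: $T=\begin{pmatrix}1&1\\0&1\end{pmatrix}$, $S=\begin{pmatrix}0&-1\\1&0\end{pmatrix}$, $R=\begin{pmatrix}0&-1\\1&1\end{pmatrix}$. Let $\mathfrak{h}$ be the upper half-plane, $\mathcal{M}^{\mathrm{an}}=[\mathrm{SL}_2(\mathbf{Z})\backslash\mathfrak{h}]$ (orbifold quotient), and $\overline{\mathcal{M}}^{\mathrm{an}}$ the compactified modular orbifold obtained by gluing $\mathcal{M}^{\mathrm{an}}$ and $[C_2\backslash\mathbf{D}]$ ($\mathbf{D}$ the unit disk, $C_2=\{\pm1\}$ acting trivially) along $[\langle -I_2,T\rangle\backslash\mathfrak{h}]\cong[C_2\backslash\mathbf{D}^\times]$ via $\tau\mapsto e^{2\pi i\tau}$. For an endomorphism $L$ of $V$ with $\rho(T)=e^{2\pi iL}$ and $k\in\mathbf{Z}$, $\overline{\mathcal{V}}_{k,L}(\rho)$ is the vector bundle on $\overline{\mathcal{M}}^{\mathrm{an}}$ obtained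 by gluing $[\mathrm{SL}_2(\mathbf{Z})\backslash(V\times\mathfrak{h})]$ (action $\gamma(v,\tau)=((c\tau+d)^k\rho(\gamma)v,\gamma\tau)$) with $[C_2\backslash(V\times\mathbf{D})]$ ($\pm1$ acting by $(\pm1)^k\rho(\pm I_2)$) via $(v,\tau)\mapsto(e^{-2\pi i\tau L}v,e^{2\pi i\tau})$. $\overline{\mathcal{L}}_k$ denotes this bundle for the trivial representation with $L=0$ (line bundle of level one weight $k$ modular forms). $\overline{\mathcal{V}}_0(\rho)$ denotes $\overline{\mathcal{V}}_{0,L}(\rho)$ with $L$ having all eigenvalues with real part in $[0,1)$. There is a decomposition $\overline{\mathcal{V}}_0(\rho)\cong\bigoplus_{i=1}^{d}\overline{\mathcal{L}}_{a_i}$, $d=\dim\rho$, with uniquely determined integers $a_1\ge\cdots\ge a_d$; these are called the roots of $\rho$. *)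

theory Defs
  imports
    "HOL-Complex_Analysis.Complex_Analysis"
    "HOL-Number_Theory.Cong"
    "HOL-Algebra.Group"
    "Jordan_Normal_Form.Char_Poly"
begin

text \<open>A finite-dimensional representation of \<open>SL\<^sub>2(Z)\<close> is a group homomorphism
  \<open>\<rho> \<in> hom SL2Z (GL d)\<close>, where a basis of \<open>V\<close> has been chosen, so that \<open>V = C\<^sup>d\<close>; every
  dimension \<open>d\<close>, including \<open>0\<close>, is allowed. Values of \<open>\<rho>\<close> off the carrier are irrelevant.\<close>

definition SL2Z :: "int mat monoid" where
  "SL2Z = \<lparr>carrier = {A \<in> carrier_mat 2 2. Determinant.det A = 1}, mult = (*), one = 1\<^sub>m 2\<rparr>"

definition GL :: "nat \<Rightarrow> complex mat monoid" where
  "GL d = units_of (ring_mat TYPE(complex) d ())"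

definition T_mat :: "int mat" where
  "T_mat = mat_of_rows_list 2 [[1, 1], [0, 1]]"

definition S_mat :: "int mat" where
  "S_mat = mat_of_rows_list 2 [[0, -1], [1, 0]]"

definition R_mat :: "int mat" where
  "R_mat = mat_of_rows_list 2 [[0, -1], [1, 1]]"

definition upper_half_plane :: "complex set" where
  "upper_half_plane = {\<tau>. Im \<tau> > 0}"

definition unit_disk :: "complex set" where
  "unit_disk = ball 0 1"

definition aut_factor :: "int mat \<Rightarrow> complex \<Rightarrow> complex" where
  "aut_factor \<gamma> \<tau> = of_int (\<gamma> $$ (1, 0)) * \<tau> + of_int (\<gamma> $$ (1, 1))"

definition moebius_act :: "int mat \<Rightarrow> complex \<Rightarrow> complex" where
  "moebius_act \<gamma> \<tau> = (of_int (\<gamma> $$ (0, 0)) * \<tau> + of_int (\<gamma> $$ (0, 1))) / aut_factor \<gamma> \<tau>"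

definition cusp_coord :: "complex \<Rightarrow> complex" where
  "cusp_coord \<tau> = exp (2 * of_real pi * \<i> * \<tau>)"

definition mat_exp :: "complex mat \<Rightarrow> complex mat" where
  "mat_exp A = Matrix.mat (dim_row A) (dim_row A) (\<lambda>(i, j). \<Sum>n. (A ^\<^sub>m n) $$ (i, j) / fact n)"

definition holomorphic_mat_on :: "(complex \<Rightarrow> complex mat) \<Rightarrow> nat \<Rightarrow> nat \<Rightarrow> complex set \<Rightarrow> bool" where
  "holomorphic_mat_on \<Phi> m n U \<longleftrightarrow>
     (\<forall>z\<in>U. \<Phi> z \<in> carrier_mat m n) \<and>
     (\<forall>i<m. \<forall>j<n. (\<lambda>z. \<Phi> z $$ (i, j)) holomorphic_on U)"


text \<open>The gluing data of a vector bundle on the compactified modular orbifold, of rank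
  \<open>n = vb_rank\<close>:
    \<^item> \<open>vb_act \<gamma> \<tau>\<close> is the fibre part of the action of \<open>\<gamma> \<in> SL\<^sub>2(Z)\<close> on
      \<open>C\<^sup>n \<times> upper_half_plane\<close>, that is \<open>\<gamma>(v, \<tau>) = (vb_act \<gamma> \<tau> v, \<gamma>\<tau>)\<close>;
    \<^item> \<open>vb_cusp_act \<epsilon> q\<close> is the fibre part of the action of \<open>\<epsilon> \<in> {1, -1} = C\<^sub>2\<close> on
      \<open>C\<^sup>n \<times> unit_disk\<close>, where \<open>C\<^sub>2\<close> acts trivially on the base;
    \<^item> the two charts are glued via \<open>(v, \<tau>) \<mapsto> (vb_glue \<tau> v, cusp_coord \<tau>)\<close>.\<close>

record modular_vb =
  vb_rank :: nat
  vb_act :: "int mat \<Rightarrow> complex \<Rightarrow> complex mat"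
  vb_cusp_act :: "int \<Rightarrow> complex \<Rightarrow> complex mat"
  vb_glue :: "complex \<Rightarrow> complex mat"

text \<open>A morphism of bundles is a pair of equivariant holomorphic families of linear maps, one on
  each chart, that agree under the gluing maps.\<close>

definition vb_morphism ::
  "modular_vb \<Rightarrow> modular_vb \<Rightarrow> (complex \<Rightarrow> complex mat) \<Rightarrow> (complex \<Rightarrow> complex mat) \<Rightarrow> bool" where
  "vb_morphism E F \<Phi> \<Psi> \<longleftrightarrow>
     holomorphic_mat_on \<Phi> (vb_rank F) (vb_rank E) upper_half_plane \<and>
     holomorphic_mat_on \<Psi> (vb_rank F) (vb_rank E) unit_disk \<and>
     (\<forall>\<gamma>\<in>carrier SL2Z. \<forall>\<tau>\<in>upper_half_plane.
        \<Phi> (moebius_act \<gamma> \<tau>) * vb_act E \<gamma> \<tau> = vb_act F \<gamma> \<tau> * \<Phi> \<tau>) \<and>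
     (\<forall>\<epsilon>\<in>{1, -1}. \<forall>q\<in>unit_disk.
        \<Psi> q * vb_cusp_act E \<epsilon> q = vb_cusp_act F \<epsilon> q * \<Psi> q) \<and>
     (\<forall>\<tau>\<in>upper_half_plane. \<Psi> (cusp_coord \<tau>) * vb_glue E \<tau> = vb_glue F \<tau> * \<Phi> \<tau>)"

definition vb_iso :: "modular_vb \<Rightarrow> modular_vb \<Rightarrow> bool" where
  "vb_iso E F \<longleftrightarrow>
     (\<exists>\<Phi> \<Psi> \<Phi>' \<Psi>'. vb_morphism E F \<Phi> \<Psi> \<and> vb_morphism F E \<Phi>' \<Psi>' \<and>
        (\<forall>\<tau>\<in>upper_half_plane. \<Phi>' \<tau> * \<Phi> \<tau> = 1\<^sub>m (vb_rank E) \<and> \<Phi> \<tau> * \<Phi>' \<tau> = 1\<^sub>m (vb_rank F)) \<and>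
        (\<forall>q\<in>unit_disk. \<Psi>' q * \<Psi> q = 1\<^sub>m (vb_rank E) \<and> \<Psi> q * \<Psi>' q = 1\<^sub>m (vb_rank F)))"

definition vb_direct_sum :: "modular_vb list \<Rightarrow> modular_vb" where
  "vb_direct_sum Es =
     \<lparr>vb_rank = sum_list (map vb_rank Es),
      vb_act = (\<lambda>\<gamma> \<tau>. diag_block_mat (map (\<lambda>E. vb_act E \<gamma> \<tau>) Es)),
      vb_cusp_act = (\<lambda>\<epsilon> q. diag_block_mat (map (\<lambda>E. vb_cusp_act E \<epsilon> q) Es)),
      vb_glue = (\<lambda>\<tau>. diag_block_mat (map (\<lambda>E. vb_glue E \<tau>) Es))\<rparr>"

definition V_bar :: "nat \<Rightarrow> int \<Rightarrow> complex mat \<Rightarrow> (int mat \<Rightarrow> complex mat) \<Rightarrow> modular_vb" where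
  "V_bar d k L \<rho> =
     \<lparr>vb_rank = d,
      vb_act = (\<lambda>\<gamma> \<tau>. (aut_factor \<gamma> \<tau> powi k) \<cdot>\<^sub>m \<rho> \<gamma>),
      vb_cusp_act = (\<lambda>\<epsilon> q. (of_int \<epsilon> powi k) \<cdot>\<^sub>m \<rho> (\<epsilon> \<cdot>\<^sub>m 1\<^sub>m 2)),
      vb_glue = (\<lambda>\<tau>. mat_exp ((- 2 * of_real pi * \<i> * \<tau>) \<cdot>\<^sub>m L))\<rparr>"

definition L_bar :: "int \<Rightarrow> modular_vb" where
  "L_bar k = V_bar 1 k (0\<^sub>m 1 1) (\<lambda>_. 1\<^sub>m 1)"

definition standard_exponent :: "nat \<Rightarrow> (int mat \<Rightarrow> complex mat) \<Rightarrow> complex mat \<Rightarrow> bool" where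
  "standard_exponent d \<rho> L \<longleftrightarrow>
     L \<in> carrier_mat d d \<and>
     \<rho> T_mat = mat_exp ((2 * of_real pi * \<i>) \<cdot>\<^sub>m L) \<and>
     (\<forall>e. eigenvalue L e \<longrightarrow> 0 \<le> Re e \<and> Re e < 1)"

text \<open>The standard exponent of an invertible matrix exists and is unique, since \<open>e \<mapsto> exp(2 \<pi> i e)\<close>
  maps the strip \<open>0 \<le> Re e < 1\<close> bijectively onto the nonzero complex numbers.\<close>

definition V_bar_0 :: "nat \<Rightarrow> (int mat \<Rightarrow> complex mat) \<Rightarrow> modular_vb" where
  "V_bar_0 d \<rho> = V_bar d 0 (THE L. standard_exponent d \<rho> L) \<rho>"

definition is_roots :: "nat \<Rightarrow> (int mat \<Rightarrow> complex mat) \<Rightarrow> int list \<Rightarrow> bool" where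
  "is_roots d \<rho> a \<longleftrightarrow>
     length a = d \<and> sorted_wrt (\<ge>) a \<and> vb_iso (V_bar_0 d \<rho>) (vb_direct_sum (map L_bar a))"

end

theory Submission
  imports Defs "Jordan_Normal_Form.Jordan_Normal_Form"
begin

text \<open>If \<open>\<gamma>\<close> fixes \<open>\<tau>\<close>, an isomorphism from the bundle of \<open>\<rho>\<close> to a sum of the line bundles
  of weights \<open>a\<^sub>j\<close> restricts on the fibre at \<open>\<tau>\<close> to a conjugation between \<open>\<rho>(\<gamma>)\<close> and the
  diagonal matrix with entries \<open>u\<close> to the power \<open>a\<^sub>j\<close>, where \<open>u\<close> is the automorphy factor of \<open>\<gamma>\<close>
  at \<open>\<tau>\<close>. For \<open>\<gamma> = S\<close> and \<open>\<tau> = \<i>\<close> one gets \<open>u = \<i>\<close>, and for \<open>\<gamma> = R\<close> and \<open>\<tau> = exp(2 \<pi> \<i> / 3)\<close>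
  one gets \<open>u = exp(2 \<pi> \<i> / 6)\<close>.\<close>

lemma GL_carrierD: "A \<in> carrier (GL d) \<Longrightarrow> A \<in> carrier_mat d d"
  by (auto simp: GL_def units_of_def Units_def ring_mat_def)

lemma vb_rank_sum_L_bar: "vb_rank (vb_direct_sum (map L_bar a)) = length a"
  by (induction a) (auto simp: vb_direct_sum_def L_bar_def V_bar_def)

text \<open>A diagonal matrix is a Jordan matrix all of whose blocks have size 1. In this form
  \<open>jordan_nf_order\<close> can read algebraic multiplicities off it.\<close>

lemma vb_act_sum_L_bar:
  "vb_act (vb_direct_sum (map L_bar a)) \<gamma> \<tau>
     = jordan_matrix (map (\<lambda>k. (1, aut_factor \<gamma> \<tau> powi k)) a)"
proof -
  have "vb_act (L_bar k) \<gamma> \<tau> = jordan_block 1 (aut_factor \<gamma> \<tau> powi k)" for k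
    by (rule eq_matI) (auto simp: L_bar_def V_bar_def jordan_block_def)
  then show ?thesis
    by (simp add: vb_direct_sum_def jordan_matrix_def o_def)
qed

lemma order_char_poly_at_fixed_point:
  assumes \<rho>: "\<rho> \<in> hom SL2Z (GL d)" and roots: "is_roots d \<rho> a"
    and \<gamma>: "\<gamma> \<in> carrier SL2Z" and \<tau>: "\<tau> \<in> upper_half_plane" and fixed: "moebius_act \<gamma> \<tau> = \<tau>"
  shows "order z (char_poly (\<rho> \<gamma>)) = card {j. j < d \<and> aut_factor \<gamma> \<tau> powi (a ! j) = z}"
proof -
  let ?E = "V_bar_0 d \<rho>" and ?F = "vb_direct_sum (map L_bar a)"
  let ?us = "map (\<lambda>k. (1, aut_factor \<gamma> \<tau> powi k)) a"
  let ?D = "jordan_matrix ?us"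
  have len: "length a = d" and iso: "vb_iso ?E ?F"
    using roots by (auto simp: is_roots_def)
  \<comment> \<open>In weight 0 the power of the automorphy factor is 1, which leaves
    \<open>\<rho> \<gamma>\<close> itself.\<close>
  have rank_E: "vb_rank ?E = d" and act_E: "vb_act ?E \<gamma> \<tau> = \<rho> \<gamma>"
    by (auto simp: V_bar_0_def V_bar_def)
  have rank_F: "vb_rank ?F = d"
    by (simp add: vb_rank_sum_L_bar len)
  obtain \<Phi> \<Psi> \<Phi>' \<Psi>' where mor: "vb_morphism ?E ?F \<Phi> \<Psi>" and mor': "vb_morphism ?F ?E \<Phi>' \<Psi>'"
    and "\<forall>\<tau>\<in>upper_half_plane. \<Phi>' \<tau> * \<Phi> \<tau> = 1\<^sub>m (vb_rank ?E) \<and> \<Phi> \<tau> * \<Phi>' \<tau> = 1\<^sub>m (vb_rank ?F)"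
    using iso unfolding vb_iso_def by blast
  then have inv: "\<Phi>' \<tau> * \<Phi> \<tau> = 1\<^sub>m d" "\<Phi> \<tau> * \<Phi>' \<tau> = 1\<^sub>m d"
    using \<tau> rank_E rank_F by auto
  have P: "\<Phi> \<tau> \<in> carrier_mat d d" and Q: "\<Phi>' \<tau> \<in> carrier_mat d d"
    using mor mor' \<tau> rank_E rank_F by (auto simp: vb_morphism_def holomorphic_mat_on_def)
  have A: "\<rho> \<gamma> \<in> carrier_mat d d"
    using \<rho> \<gamma> by (auto simp: hom_def intro: GL_carrierD)
  have D: "?D \<in> carrier_mat d d"
    by (rule carrier_matI) (simp_all add: o_def len sum_list_triv)
  \<comment> \<open>Since \<open>\<gamma>\<close> fixes \<open>\<tau>\<close>, both sides of the
    equivariance relation involve the same matrix \<open>\<Phi> \<tau>\<close>.\<close>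
  have "\<Phi> \<tau> * \<rho> \<gamma> = ?D * \<Phi> \<tau>"
    using mor \<gamma> \<tau> fixed act_E unfolding vb_morphism_def vb_act_sum_L_bar by metis
  then have "\<Phi>' \<tau> * (\<Phi> \<tau> * \<rho> \<gamma>) = \<Phi>' \<tau> * ?D * \<Phi> \<tau>"
    using assoc_mult_mat[OF Q D P] by simp
  then have "\<rho> \<gamma> = \<Phi>' \<tau> * ?D * \<Phi> \<tau>"
    using assoc_mult_mat[OF Q P A] inv A by simp
  then have "similar_mat (\<rho> \<gamma>) ?D"
    using A D P Q inv by (intro similar_matI[of _ _ "\<Phi>' \<tau>" "\<Phi> \<tau>" d]) auto
  then have "jordan_nf (\<rho> \<gamma>) ?us"
    by (auto simp: jordan_nf_def)
  \<comment> \<open>The order at \<open>z\<close> is the sum of the sizes of the blocks with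
    eigenvalue \<open>z\<close>; as all sizes are 1, it counts those blocks.\<close>
  then have "order z (char_poly (\<rho> \<gamma>)) = length (filter (\<lambda>k. aut_factor \<gamma> \<tau> powi k = z) a)"
    by (simp add: jordan_nf_order filter_map o_def sum_list_triv)
  then show ?thesis
    by (simp add: length_filter_conv_card len)
qed

text \<open>The base is a primitive root of unity of order \<open>n\<close>. The exponent
  \<open>k\<close> is an integer because roots may be negative.\<close>

lemma root_of_unity_powi_eq_iff:
  assumes "n > 0"
  shows "exp (2 * of_real pi * \<i> / of_nat n) powi k = exp (2 * of_real pi * \<i> / of_nat n) ^ s
           \<longleftrightarrow> [k = int s] (mod int n)"
proof -
  let ?u = "exp (2 * of_real pi * \<i> / of_nat n)"
  have "?u powi k = ?u ^ s \<longleftrightarrow> ?u powi (k - int s) = 1"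
    by (simp add: power_int_diff)
  also have "?u powi (k - int s) = exp (of_int (k - int s) * (2 * of_real pi * \<i> / of_nat n))"
    by (simp only: exp_power_int)
  also have "\<dots> = 1 \<longleftrightarrow> (\<exists>m::int. of_int (k - int s) = (of_int (m * int n) :: real))"
  proof -
    \<comment> \<open>The criterion \<open>exp_eq_1\<close> asks for an imaginary part that is an
      even multiple of \<open>pi\<close>; the factor \<open>2 * pi / n\<close> is cancelled
      here.\<close>
    have "2 * pi * x / real n = real_of_int (2 * m) * pi \<longleftrightarrow> x = of_int (m * int n)" for x m
    proof -
      have "2 * pi * x / real n = real_of_int (2 * m) * pi
              \<longleftrightarrow> 2 * pi * x = 2 * pi * of_int (m * int n)"
        using assms by (simp add: field_simps)
      then show ?thesis by simp
    qed
    from this[of "of_int (k - int s)"] show ?thesis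
      by (simp add: exp_eq_1 mult.commute[of "of_int k - of_nat s"] del: of_int_mult)
  qed
  also have "\<dots> \<longleftrightarrow> [k = int s] (mod int n)"
    unfolding of_int_eq_iff by (auto simp: cong_iff_dvd_diff dvd_def mult.commute)
  finally show ?thesis .
qed

text \<open>This is the common form of both claims, applied with \<open>n = 4\<close> for
  \<open>S_mat\<close> and \<open>n = 6\<close> for \<open>R_mat\<close>.\<close>

lemma card_roots_cong:
  assumes "\<rho> \<in> hom SL2Z (GL d)" and "is_roots d \<rho> a"
    and "\<gamma> \<in> carrier SL2Z" and "\<tau> \<in> upper_half_plane" and "moebius_act \<gamma> \<tau> = \<tau>"
    and u: "aut_factor \<gamma> \<tau> = exp (2 * of_real pi * \<i> / of_nat n)" and "n > 0"
  shows "card {j. j < d \<and> [a ! j = int s] (mod int n)}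
           = order (exp (2 * of_real pi * \<i> / of_nat n) ^ s) (char_poly (\<rho> \<gamma>))"
  using order_char_poly_at_fixed_point[OF assms(1-5)] assms(7)
  by (simp add: u root_of_unity_powi_eq_iff)

lemma det_mat_two:
  "Determinant.det (mat_of_rows_list 2 [[a, b], [c, d]])
     = a * d - b * (c :: 'a :: comm_ring_1)"
proof -
  have "Determinant.det (mat_of_rows_list 2 [[a, b], [c, d]])
      = (\<Sum>j<2. mat_of_rows_list 2 [[a, b], [c, d]] $$ (0, j)
           * cofactor (mat_of_rows_list 2 [[a, b], [c, d]]) 0 j)"
    by (rule laplace_expansion_row) (auto simp: mat_of_rows_list_def)
  also have "\<dots> = a * d - b * c"
    by (simp add: numeral_2_eq_2 cofactor_def det_single mat_delete_def mat_of_rows_list_def)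
  finally show ?thesis .
qed

lemma S_mat_carrier: "S_mat \<in> carrier SL2Z"
  by (simp add: S_mat_def SL2Z_def det_mat_two) (auto simp: mat_of_rows_list_def)

lemma R_mat_carrier: "R_mat \<in> carrier SL2Z"
  by (simp add: R_mat_def SL2Z_def det_mat_two) (auto simp: mat_of_rows_list_def)

lemma exp_quarter_turn: "exp (2 * of_real pi * \<i> / 4) = \<i>"
  by (simp add: exp_eq_polar cis.code complex_eq_iff)

text \<open>Cartesian coordinates allow the automorphy factor of \<open>R_mat\<close> to be compared
  by real and imaginary parts.\<close>

lemma exp_sixth_turn: "exp (2 * of_real pi * \<i> / 6) = Complex (1 / 2) (sqrt 3 / 2)"
proof -
  have "exp (2 * of_real pi * \<i> / 6) = cis (pi / 3)"
    by (simp add: cis_conv_exp mult.commute)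
  then show ?thesis
    by (simp add: complex_eq_iff cos_60 sin_60)
qed

theorem theorem5p3:
  fixes d :: nat and \<rho> :: "int mat \<Rightarrow> complex mat" and a :: "int list"
  assumes "\<rho> \<in> hom SL2Z (GL d)"
    and "is_roots d \<rho> a"
  shows "(\<forall>s::nat\<in>{0..3}.
            card {j. j < d \<and> [a ! j = int s] (mod 4)}
              = Polynomial.order (\<i> ^ s) (char_poly (\<rho> S_mat))) \<and>
         (\<forall>r::nat\<in>{0..5}.
            card {j. j < d \<and> [a ! j = int r] (mod 6)}
              = Polynomial.order (exp (2 * of_real pi * \<i> / 6) ^ r) (char_poly (\<rho> R_mat)))"
proof (intro conjI ballI)
  fix s :: nat
  \<comment> \<open>\<open>S_mat\<close> acts by sending \<open>\<tau>\<close> to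
    \<open>- 1 / \<tau>\<close>, with automorphy factor \<open>\<tau>\<close>.\<close>
  have "aut_factor S_mat \<i> = \<i>" "moebius_act S_mat \<i> = \<i>" "\<i> \<in> upper_half_plane"
    by (simp_all add: aut_factor_def moebius_act_def S_mat_def mat_of_rows_list_def
        upper_half_plane_def)
  then show "card {j. j < d \<and> [a ! j = int s] (mod 4)} = order (\<i> ^ s) (char_poly (\<rho> S_mat))"
    using card_roots_cong[OF assms S_mat_carrier, of \<i> 4 s,
        unfolded of_nat_numeral exp_quarter_turn] by simp
next
  fix r :: nat
  \<comment> \<open>\<open>R_mat\<close> sends \<open>\<tau>\<close> to
    \<open>- 1 / (\<tau> + 1)\<close>, so its fixed points solve
    \<open>\<tau>^2 + \<tau> + 1 = 0\<close>; this is the solution in the upper half-plane. The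
    factor \<open>\<tau> + 1\<close> is then the primitive sixth root of unity.\<close>
  let ?\<omega> = "Complex (- 1 / 2) (sqrt 3 / 2)"
  have "aut_factor R_mat ?\<omega> = exp (2 * of_real pi * \<i> / 6)" "?\<omega> \<in> upper_half_plane"
    unfolding exp_sixth_turn
    by (simp_all add: aut_factor_def R_mat_def mat_of_rows_list_def upper_half_plane_def
        complex_eq_iff)
  moreover have "moebius_act R_mat ?\<omega> = ?\<omega>"
  proof -
    \<comment> \<open>This is the fixed point equation with its denominator cleared.\<close>
    have "?\<omega> + 1 \<noteq> 0" and "?\<omega> * (?\<omega> + 1) = - 1"
      by (simp_all add: complex_eq_iff)
    then show ?thesis
      by (simp add: moebius_act_def aut_factor_def R_mat_def mat_of_rows_list_def field_simps)
  qed
  ultimately show "card {j. j < d \<and> [a ! j = int r] (mod 6)}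
      = order (exp (2 * of_real pi * \<i> / 6) ^ r) (char_poly (\<rho> R_mat))"
    using card_roots_cong[OF assms R_mat_carrier, of ?\<omega> 6 r] by simp
qed

end
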